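(* For all integers $n\geq 2$ and $m\geq 1$, $$\xi_{n,m}\geq q_{n,m}\cdot\varsigma_{n,m}^{\,m-1},$$ where $$q_{n,m}:=\begin{cases}1,& n\geq m,\\ \dfrac{(m-1)!}{(m-1)^{m-1}},& n<m,\end{cases}\qquad \varsigma_{n,m}:=\frac{n-(m)_{n-1}}{n^{\lfloor \frac{m}{n-1}\rfloor+1}},$$ and $(m)_{n-1}$ is the remainder from the division of $m$ by $n-1$. Moreover, for every $m\geq 1$ we have $\lim_{n\to\infty}\xi_{n,m}=1$.
   Context: Let $X$ be a finite alphabet with $n\ge 2$ letters. A code with length distribution $L=(a_1,\ldots,a_m)$, where the $a_i$ are positive integers, is a finite sequence $(v_1,\ldots,v_m)$ of words $v_i\in X^*$ with $|v_i|=a_i$ for all $i$. A code is a prefix code if it is an injective sequence of non-empty words such that no $v_i$ is a prefix (initial segment) of another code word $v_j$, $j\ne i$. A code $(v_1,\ldots,v_m)$ is uniquely decodable if $v_{i_1}v_{i_2}\cdots v_{i_t}=v_{j_1}v_{j_2}\cdots v_{j_{t'}}$ with $t,t'\geq 1$ and all indices in $\{1,\ldots,m\}$ implies $t=t'$ and $i_s=j_s$ for every $1\leq s\leq t$. $UD_n(L)$ denotes the set of uniquely decodable codes over an $n$-letter alphabet with length distribution $L$, and $PR_n(L)\subseteq UD_n(L)$ the subset of prefix codes. $\mathcal{L}_{n,m}$ is the set of sequences $L$ of positive integers of length $|L|=m$ with $UD_n(L)\neq\emptyset$ (equivalently, by Kraft-McMillan, $PR_n(L)\ne\emptyset$, equivalently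 $\sum_{i=1}^m n^{-a_i}\leq 1$). Define $$\xi_{n,m}:=\inf_{L\in\mathcal{L}_{n,m}}\frac{|PR_n(L)|}{|UD_n(L)|}.$$ *)

theory Defs
  imports Complex_Main "HOL-Library.Sublist"
begin

text \<open>
  A code is a finite sequence of words, i.e. a list of lists; indices run over
  \<open>{..<length vs}\<close> instead of \<open>{1..m}\<close>.
\<close>

definition codes :: "'a set \<Rightarrow> nat list \<Rightarrow> 'a list list set" where
  "codes X L = {vs. length vs = length L \<and>
     (\<forall>i<length L. length (vs ! i) = L ! i \<and> set (vs ! i) \<subseteq> X)}"

definition prefix_code :: "'a list list \<Rightarrow> bool" where
  "prefix_code vs \<longleftrightarrow> distinct vs \<and> [] \<notin> set vs \<and>
     (\<forall>i<length vs. \<forall>j<length vs. i \<noteq> j \<longrightarrow> \<not> prefix (vs ! i) (vs ! j))"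

text \<open>Equality of the index lists \<open>is\<close> and \<open>js\<close> comprises equality of their lengths.\<close>

definition uniquely_decodable :: "'a list list \<Rightarrow> bool" where
  "uniquely_decodable vs \<longleftrightarrow>
     (\<forall>is js. is \<noteq> [] \<and> js \<noteq> [] \<and>
        set is \<subseteq> {..<length vs} \<and> set js \<subseteq> {..<length vs} \<and>
        concat (map (\<lambda>i. vs ! i) is) = concat (map (\<lambda>j. vs ! j) js) \<longrightarrow> is = js)"

text \<open>The set \<open>{..<n}\<close> of natural numbers serves as the alphabet with \<open>n\<close> letters.\<close>

definition UD :: "nat \<Rightarrow> nat list \<Rightarrow> nat list list set" where
  "UD n L = {vs \<in> codes {..<n} L. uniquely_decodable vs}"

definition PR :: "nat \<Rightarrow> nat list \<Rightarrow> nat list list set" where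
  "PR n L = {vs \<in> codes {..<n} L. prefix_code vs}"

definition length_dists :: "nat \<Rightarrow> nat \<Rightarrow> nat list set" where
  "length_dists n m = {L. length L = m \<and> (\<forall>a\<in>set L. 0 < a) \<and> UD n L \<noteq> {}}"

definition xi :: "nat \<Rightarrow> nat \<Rightarrow> real" where
  "xi n m = (INF L\<in>length_dists n m. real (card (PR n L)) / real (card (UD n L)))"

definition q_coeff :: "nat \<Rightarrow> nat \<Rightarrow> real" where
  "q_coeff n m = (if n \<ge> m then 1 else fact (m - 1) / real (m - 1) ^ (m - 1))"

definition varsigma :: "nat \<Rightarrow> nat \<Rightarrow> real" where
  "varsigma n m = (real n - real (m mod (n - 1))) / real n ^ (m div (n - 1) + 1)"

end

theory Submission
  imports Defs "HOL-Library.FuncSet"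
begin

text \<open>
  There are at most \<open>n ^ (\<Sum>i. a\<^sub>i)\<close> codes with length distribution \<open>L\<close>, while choosing the code
  words in the order of increasing lengths shows that at least
  \<open>n ^ (\<Sum>i. a\<^sub>i) * (\<Prod>i. 1 - (\<Sum>j<i. n powr - a\<^sub>j))\<close> of them are prefix codes.
  By McMillan's inequality every factor is positive, and a positive Kraft defect of \<open>k\<close> lengths is
  at least \<open>varsigma n k\<close>, the value attained by taking \<open>n - 1\<close> words of each length
  \<open>1, 2, 3, \<dots>\<close> in turn. The first factor is \<open>1\<close>, which leaves \<open>m - 1\<close> factors.
\<close>

section \<open>Words and codes\<close>

definition words :: "'a set \<Rightarrow> nat \<Rightarrow> 'a list set" where
  "words X N = {w. set w \<subseteq> X \<and> length w = N}"

lemma finite_words: "finite X \<Longrightarrow> finite (words X N)"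
  unfolding words_def by (rule finite_lists_length_eq)

lemma card_words: "finite X \<Longrightarrow> card (words X N) = card X ^ N"
  unfolding words_def by (rule card_lists_length_eq)

lemma card_words_with_prefix:
  assumes "finite X" "u \<in> words X k" "k \<le> N"
  shows "card {w \<in> words X N. prefix u w} = card X ^ (N - k)"
proof -
  have "{w \<in> words X N. prefix u w} = (@) u ` words X (N - k)"
    using assms by (auto simp: words_def prefix_def image_iff)
  then show ?thesis
    using assms by (simp add: card_image inj_on_def card_words)
qed

text \<open>Only an upper bound on the number of codes is wanted, so an injection into a dependent
  product, whose cardinality is known, is enough.\<close>

lemma codes_inj_PiE:
  "inj_on (\<lambda>vs. \<lambda>i\<in>{..<length L}. vs ! i) (codes X L)"
  "(\<lambda>vs. \<lambda>i\<in>{..<length L}. vs ! i) ` codes X L \<subseteq> (\<Pi>\<^sub>E i\<in>{..<length L}. words X (L ! i))"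
proof -
  show "inj_on (\<lambda>vs. \<lambda>i\<in>{..<length L}. vs ! i) (codes X L)"
  proof (rule inj_onI)
    fix vs ws
    assume *: "vs \<in> codes X L" "ws \<in> codes X L"
      "(\<lambda>i\<in>{..<length L}. vs ! i) = (\<lambda>i\<in>{..<length L}. ws ! i)"
    have "vs ! i = ws ! i" if "i < length L" for i
      using fun_cong[OF *(3), of i] that by simp
    then show "vs = ws"
      using * by (auto simp: codes_def intro: nth_equalityI)
  qed
qed (force simp: codes_def words_def)

lemma finite_codes:
  assumes "finite X"
  shows "finite (codes X L)"
  using assms by (intro inj_on_finite[OF codes_inj_PiE] finite_PiE) (auto simp: finite_words)

lemma card_codes_le:
  assumes "finite X"
  shows "card (codes X L) \<le> card X ^ (\<Sum>i<length L. L ! i)"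
proof -
  have "card (codes X L) \<le> card (\<Pi>\<^sub>E i\<in>{..<length L}. words X (L ! i))"
    using codes_inj_PiE[of L X] assms by (intro card_inj_on_le finite_PiE) (auto simp: finite_words)
  also have "\<dots> = card X ^ (\<Sum>i<length L. L ! i)"
    using assms by (simp add: card_PiE card_words power_sum)
  finally show ?thesis .
qed

text \<open>In two equal concatenations the first code words are prefixes of the same word, hence
  comparable, hence they have the same index. They cancel, and induction finishes.\<close>

lemma prefix_code_imp_uniquely_decodable:
  assumes "prefix_code vs"
  shows "uniquely_decodable vs"
proof -
  \<comment> \<open>This settles the base cases below: only the empty index list has an empty
    concatenation.\<close>
  have ne: "vs ! i \<noteq> []" if "i < length vs" for i
    using assms that nth_mem unfolding prefix_code_def by metis
  have "is = js"
    if "set is \<subseteq> {..<length vs}" "set js \<subseteq> {..<length vs}"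
      "concat (map (\<lambda>i. vs ! i) is) = concat (map (\<lambda>j. vs ! j) js)" for "is" js
    using that
  proof (induction "is" arbitrary: js)
    case Nil
    then show ?case by (cases js) (auto simp: ne)
  next
    case (Cons i "is")
    then obtain j js' where js: "js = j # js'"
      by (cases js) (auto simp: ne)
    have eq: "vs ! i @ concat (map (\<lambda>i. vs ! i) is) = vs ! j @ concat (map (\<lambda>i. vs ! i) js')"
      using Cons.prems js by simp
    then have "prefix (vs ! i) (vs ! j) \<or> prefix (vs ! j) (vs ! i)"
      by (metis prefixI prefix_same_cases)
    then have "i = j"
      using assms Cons.prems js unfolding prefix_code_def by auto
    then show ?case
      using Cons js eq by auto
  qed
  then show ?thesis
    unfolding uniquely_decodable_def by blast
qed

lemma PR_subset_UD: "PR n L \<subseteq> UD n L"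
  by (auto simp: PR_def UD_def prefix_code_imp_uniquely_decodable)

lemma finite_UD: "finite (UD n L)"
  unfolding UD_def by (rule finite_subset[OF _ finite_codes[of "{..<n}" L]]) auto

section \<open>McMillan's inequality\<close>

text \<open>If \<open>x > 1\<close>, dividing by \<open>x ^ k\<close> would bound 1 by a null
  sequence, since a geometric decay beats linear growth.\<close>

lemma le_one_if_powers_linearly_bounded:
  fixes x :: real
  assumes "\<And>k::nat. x ^ k \<le> real k * C + 1"
  shows "x \<le> 1"
proof (rule ccontr)
  assume "\<not> x \<le> 1"
  then have x: "1 < x" by simp
  have "((\<lambda>k. real k * (1 / x) ^ k) \<longlongrightarrow> 0) sequentially"
    using x by (intro powser_times_n_limit_0) auto
  moreover have "((\<lambda>k. (1 / x) ^ k) \<longlongrightarrow> 0) sequentially"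
    using x by (intro LIMSEQ_power_zero) auto
  ultimately have "(\<lambda>k. real k * (1 / x) ^ k * C + (1 / x) ^ k) \<longlonglongrightarrow> 0 * C + 0"
    by (intro tendsto_add tendsto_mult_right)
  moreover have "1 \<le> real k * (1 / x) ^ k * C + (1 / x) ^ k" for k
  proof -
    have "x ^ k * (1 / x) ^ k \<le> (real k * C + 1) * (1 / x) ^ k"
      using x by (intro mult_right_mono assms) auto
    then show ?thesis
      using x by (simp add: power_mult_distrib[symmetric] algebra_simps)
  qed
  ultimately have "1 \<le> 0 * C + (0::real)"
    by (intro LIMSEQ_le_const) auto
  then show False by simp
qed

text \<open>Distributivity picks one summand from each of the \<open>k\<close> factors; the lists of
  length \<open>k\<close> over the alphabet \<open>A\<close> record the choices.\<close>

lemma sum_power_eq_sum_lists: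
  fixes f :: "'b \<Rightarrow> 'a::comm_semiring_1"
  assumes "finite A"
  shows "sum f A ^ k = (\<Sum>xs\<in>words A k. prod_list (map f xs))"
proof (induction k)
  case 0
  have "words A 0 = {[]}" by (auto simp: words_def)
  then show ?case by simp
next
  case (Suc k)
  have eq: "words A (Suc k) = (\<lambda>(x, xs). x # xs) ` (A \<times> words A k)"
    by (auto simp: words_def length_Suc_conv image_iff)
  have "sum f A ^ Suc k = (\<Sum>(x, xs)\<in>A \<times> words A k. f x * prod_list (map f xs))"
    by (simp add: Suc sum_product sum.cartesian_product)
  also have "\<dots> = (\<Sum>xs\<in>words A (Suc k). prod_list (map f xs))"
    unfolding eq by (subst sum.reindex) (auto simp: inj_on_def case_prod_unfold)
  finally show ?case .
qed

text \<open>Karush's argument: expand the \<open>k\<close>-th power of the Kraft sum over index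
  lists of length \<open>k\<close> and group them by the total length \<open>l\<close> of their
  concatenations. Unique decodability allows at most \<open>card X ^ l\<close> lists per group, so
  each group contributes at most 1, and the number of groups grows linearly in
  \<open>k\<close>.\<close>

lemma mcmillan_inequality:
  assumes X: "finite X" "X \<noteq> {}" and vs: "vs \<in> codes X L" "uniquely_decodable vs"
  shows "(\<Sum>i<length L. 1 / real (card X) ^ (L ! i)) \<le> 1"
proof (rule le_one_if_powers_linearly_bounded)
  fix k :: nat
  let ?A = "{..<length L}" and ?n = "real (card X)"
  \<comment> \<open>A crude bound for every single length, so that \<open>k\<close> words have total
    length at most \<open>k * ?M\<close>.\<close>
  let ?M = "sum_list L"
  let ?len = "\<lambda>is. \<Sum>i\<leftarrow>is. L ! i"
  let ?c = "\<lambda>is. concat (map (\<lambda>i. vs ! i) is)"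
  have n: "?n > 0" using X by (simp add: card_gt_0_iff)
  have fin: "finite (words ?A k)" by (simp add: finite_words)
  have len: "?len is \<le> k * ?M" if "is \<in> words ?A k" for "is"
  proof -
    have "?len is \<le> (\<Sum>i\<leftarrow>is. ?M)"
      using that by (intro sum_list_mono elem_le_sum_list) (auto simp: words_def)
    then show ?thesis using that by (simp add: words_def sum_list_triv)
  qed
  have c: "?c is \<in> words X (?len is)" if "is \<in> words ?A k" for "is"
  proof -
    have "set is \<subseteq> ?A" using that by (simp add: words_def)
    then show ?thesis
      by (induction "is") (use vs(1) in \<open>auto simp: words_def codes_def\<close>)
  qed
  have card_le: "card {is \<in> words ?A k. ?len is = l} \<le> card X ^ l" for l
  \<comment> \<open>Unique decodability speaks about nonempty index lists only, so the empty list is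
    counted by hand.\<close>
  proof (cases "k = 0")
    case True
    have "{is \<in> words ?A k. ?len is = l} \<subseteq> (if l = 0 then {[]} else {})"
      using True by (auto simp: words_def)
    then have "card {is \<in> words ?A k. ?len is = l} \<le> card (if l = 0 then {[]::nat list} else {})"
      by (intro card_mono) auto
    then show ?thesis by (auto split: if_splits)
  next
    case False
    have "card {is \<in> words ?A k. ?len is = l} \<le> card (words X l)"
    proof (rule card_inj_on_le[where f = ?c])
      show "inj_on ?c {is \<in> words ?A k. ?len is = l}"
      proof (rule inj_onI)
        fix xs ys assume *: "xs \<in> {is \<in> words ?A k. ?len is = l}"
          "ys \<in> {is \<in> words ?A k. ?len is = l}" "?c xs = ?c ys"
        moreover have "length vs = length L" using vs(1) by (simp add: codes_def)
        ultimately have "xs \<noteq> []" "ys \<noteq> []" "set xs \<subseteq> {..<length vs}" "set ys \<subseteq> {..<length vs}"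
          using False by (auto simp: words_def)
        then show "xs = ys"
          using vs(2) *(3) unfolding uniquely_decodable_def by blast
      qed
      show "?c ` {is \<in> words ?A k. ?len is = l} \<subseteq> words X l"
        using c by blast
    qed (simp add: finite_words X)
    then show ?thesis by (simp add: card_words X)
  qed
  have prod: "prod_list (map (\<lambda>i. 1 / ?n ^ (L ! i)) is) = 1 / ?n ^ ?len is" for "is"
    by (induction "is") (auto simp: power_add)
  have "(\<Sum>i<length L. 1 / ?n ^ (L ! i)) ^ k = (\<Sum>is\<in>words ?A k. 1 / ?n ^ ?len is)"
    by (subst sum_power_eq_sum_lists) (auto simp: prod)
  also have "\<dots> = (\<Sum>l\<le>k * ?M. \<Sum>is | is \<in> words ?A k \<and> ?len is = l. 1 / ?n ^ ?len is)"
    by (rule sum.group[symmetric]) (use fin len in auto)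
  also have "\<dots> \<le> (\<Sum>l\<le>k * ?M. 1)"
  proof (rule sum_mono)
    fix l
    have "(\<Sum>is | is \<in> words ?A k \<and> ?len is = l. 1 / ?n ^ ?len is)
        = real (card {is \<in> words ?A k. ?len is = l}) / ?n ^ l"
      by simp
    also have "\<dots> \<le> 1"
      using card_le[of l] n by (simp add: divide_le_eq flip: of_nat_power)
    finally show "(\<Sum>is | is \<in> words ?A k \<and> ?len is = l. 1 / ?n ^ ?len is) \<le> 1" .
  qed
  also have "\<dots> = real k * real ?M + 1" by simp
  finally show "(\<Sum>i<length L. 1 / ?n ^ (L ! i)) ^ k \<le> real k * real ?M + 1" .
qed

section \<open>The smallest positive Kraft defect\<close>

lemma varsigma_0: "n \<ge> 2 \<Longrightarrow> varsigma n 0 = 1"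
  by (simp add: varsigma_def)

text \<open>The recursion identifies \<open>varsigma n k\<close> as the Kraft defect of the first
  \<open>k\<close> terms of the sequence in which each length 1, 2, 3, ... occurs
  \<open>n - 1\<close> times; the term after these is \<open>k div (n - 1) + 1\<close>.\<close>

lemma varsigma_Suc:
  assumes "n \<ge> 2"
  shows "varsigma n (Suc k) = varsigma n k - 1 / real n ^ (k div (n - 1) + 1)"
proof (cases "Suc (k mod (n - 1)) = n - 1")
  \<comment> \<open>A level is completed: the numerator on the right drops from 2 to 1, which the
    left side writes as \<open>n\<close> over the next power of \<open>n\<close>.\<close>
  case True
  then have "Suc k mod (n - 1) = 0" "Suc k div (n - 1) = Suc (k div (n - 1))"
    by (auto simp: mod_Suc div_Suc)
  moreover have "real n = real (k mod (n - 1)) + 2"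
    using True assms by linarith
  ultimately show ?thesis
    using assms by (simp add: varsigma_def flip: diff_divide_distrib)
next
  case False
  then have "Suc k mod (n - 1) = Suc (k mod (n - 1))" "Suc k div (n - 1) = k div (n - 1)"
    by (auto simp: mod_Suc div_Suc)
  then show ?thesis
    using assms by (simp add: varsigma_def flip: diff_divide_distrib)
qed

lemma varsigma_antimono:
  assumes "n \<ge> 2" "k \<le> l"
  shows "varsigma n l \<le> varsigma n k"
  by (rule lift_Suc_antimono_le[of "varsigma n"]) (use assms in \<open>auto simp: varsigma_Suc\<close>)

lemma varsigma_pos:
  assumes "n \<ge> 2"
  shows "0 < varsigma n k"
proof -
  have "k mod (n - 1) < n - 1" using assms by simp
  then have "k mod (n - 1) < n" by linarith
  then show ?thesis unfolding varsigma_def using assms by (intro divide_pos_pos) auto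
qed

lemma varsigma_mult:
  assumes "n \<ge> 2"
  shows "varsigma n (q * (n - 1)) = 1 / real n ^ q"
  using assms by (simp add: varsigma_def)

text \<open>Elements are added in order of increasing \<open>a\<close>. A new length above
  \<open>q\<close> lowers the defect by no more than the recursion of \<open>varsigma\<close> does.
  A new length of at most \<open>q\<close> makes all lengths so short that integrality alone keeps
  the positive defect at least \<open>1 / n ^ q\<close>.\<close>

lemma kraft_defect_ge_varsigma:
  fixes a :: "'b \<Rightarrow> nat"
  assumes n: "n \<ge> 2" and "finite S" and "(\<Sum>i\<in>S. 1 / real n ^ a i) < 1"
  shows "varsigma n (card S) \<le> 1 - (\<Sum>i\<in>S. 1 / real n ^ a i)"
  using assms(2,3)
proof (induction S rule: finite_ranking_induct[where f = a])
  case empty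
  then show ?case using n by (simp add: varsigma_0)
next
  case (insert x S)
  show ?case
  proof (cases "x \<in> S")
    \<comment> \<open>The ranking induction may insert an element already present; then nothing
      changes.\<close>
    case True
    then show ?thesis using insert by (simp add: insert_absorb)
  next
    case False
    define q where "q = card S div (n - 1)"
    define R where "R = 1 - (\<Sum>i\<in>insert x S. 1 / real n ^ a i)"
    have R: "R = 1 - (\<Sum>i\<in>S. 1 / real n ^ a i) - 1 / real n ^ a x" and "R > 0"
      using False insert by (auto simp: R_def)
    show ?thesis
    proof (cases "q < a x")
      case True
      \<comment> \<open>Removing \<open>x\<close> does not decrease the defect, so it is positive
        for \<open>S\<close> too and the induction hypothesis applies.\<close>
      have "1 / real n ^ a x \<ge> 0" by simp
      then have "varsigma n (card S) \<le> 1 - (\<Sum>i\<in>S. 1 / real n ^ a i)"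
        using insert.IH \<open>R > 0\<close> R by linarith
      moreover have "1 / real n ^ a x \<le> 1 / real n ^ (q + 1)"
        using True n by (intro divide_left_mono power_increasing) auto
      ultimately show ?thesis
        using False insert.hyps n by (simp add: varsigma_Suc q_def)
    next
      case False': False
      text \<open>\<open>R\<close> is a positive multiple of \<open>1 / n ^ a x\<close>, as \<open>a x\<close> is the largest length.\<close>
      have "R * real n ^ a x = real n ^ a x - (\<Sum>i\<in>insert x S. real n ^ a x / real n ^ a i)"
        by (simp add: R_def left_diff_distrib sum_distrib_right)
      also have "(\<Sum>i\<in>insert x S. real n ^ a x / real n ^ a i) = (\<Sum>i\<in>insert x S. real n ^ (a x - a i))"
        by (rule sum.cong) (use n insert.hyps in \<open>auto simp: power_diff\<close>)
      also have "real n ^ a x - \<dots> = real_of_int (int n ^ a x - (\<Sum>i\<in>insert x S. int n ^ (a x - a i)))"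
        by simp
      finally obtain z :: int where z: "R * real n ^ a x = real_of_int z" by blast
      moreover have "R * real n ^ a x > 0" using \<open>R > 0\<close> n by simp
      ultimately have "R * real n ^ a x \<ge> 1" by simp
      then have "1 / real n ^ a x \<le> R" using n by (simp add: divide_le_eq)
      moreover have "1 / real n ^ q \<le> 1 / real n ^ a x"
        using False' n by (intro divide_left_mono power_increasing) auto
      \<comment> \<open>By the choice of \<open>q\<close>, \<open>q * (n - 1)\<close> is at most
        \<open>card S\<close>.\<close>
      moreover have "varsigma n (card (insert x S)) \<le> varsigma n (q * (n - 1))"
        using n False insert.hyps
        by (intro varsigma_antimono) (auto simp: q_def intro: le_SucI)
      ultimately show ?thesis
        unfolding varsigma_mult[OF n] R_def by linarith
    qed
  qed
qed

section \<open>Counting prefix codes\<close>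

text \<open>Families over an arbitrary index set, rather than lists, let the code words be chosen in
  order of length whatever their positions in the code.\<close>

definition prefix_families :: "'a set \<Rightarrow> ('i \<Rightarrow> nat) \<Rightarrow> 'i set \<Rightarrow> ('i \<Rightarrow> 'a list) set" where
  "prefix_families X a I = {v \<in> \<Pi>\<^sub>E i\<in>I. words X (a i). \<forall>i\<in>I. \<forall>j\<in>I. i \<noteq> j \<longrightarrow> \<not> prefix (v i) (v j)}"

lemma finite_prefix_families: "finite X \<Longrightarrow> finite I \<Longrightarrow> finite (prefix_families X a I)"
  unfolding prefix_families_def by (simp add: finite_PiE finite_words)

text \<open>The new word is at least as long as the others, so it can be a prefix of one of them
  only by being equal to it, and then that one is also a prefix of the new word.\<close>

lemma prefix_families_insert:
  assumes "x \<notin> S" "\<And>y. y \<in> S \<Longrightarrow> a y \<le> a x"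
    and "v \<in> prefix_families X a S" "w \<in> words X (a x)" "\<forall>j\<in>S. \<not> prefix (v j) w"
  shows "v(x := w) \<in> prefix_families X a (insert x S)"
proof -
  have v: "v \<in> (\<Pi>\<^sub>E i\<in>S. words X (a i))" and
    pf: "\<And>i j. i \<in> S \<Longrightarrow> j \<in> S \<Longrightarrow> i \<noteq> j \<Longrightarrow> \<not> prefix (v i) (v j)"
    using assms(3) by (auto simp: prefix_families_def)
  have "\<not> prefix w (v j)" if "j \<in> S" for j
  proof
    assume p: "prefix w (v j)"
    have "length (v j) \<le> length w"
      using v that assms(2,4) by (auto simp: words_def PiE_iff)
    then have "w = v j" using p by (auto simp: prefix_def)
    then show False using assms(5) that by auto
  qed
  then show ?thesis
    using v pf assms unfolding prefix_families_def by (auto simp: PiE_iff extensional_def)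
qed

text \<open>Each chosen word \<open>v j\<close> forbids its \<open>n ^ (a x - a j)\<close>
  extensions of length \<open>a x\<close>, where \<open>n = card X\<close>. \<open>?B v\<close>
  collects the forbidden words, and the union bound estimates the set \<open>?W v\<close> of
  admissible ones from below.\<close>

lemma card_prefix_families_insert:
  fixes a :: "'i \<Rightarrow> nat"
  assumes "finite X" "X \<noteq> {}" "finite S" "x \<notin> S" "\<And>y. y \<in> S \<Longrightarrow> a y \<le> a x"
  shows "real (card (prefix_families X a S)) * real (card X) ^ a x
      * (1 - (\<Sum>j\<in>S. 1 / real (card X) ^ a j)) \<le> real (card (prefix_families X a (insert x S)))"
proof -
  let ?n = "real (card X)"
  let ?B = "\<lambda>v. \<Union>j\<in>S. {w \<in> words X (a x). prefix (v j) w}"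
  let ?W = "\<lambda>v. words X (a x) - ?B v"
  have n: "?n > 0" using assms by (simp add: card_gt_0_iff)
  have W: "?n ^ a x * (1 - (\<Sum>j\<in>S. 1 / ?n ^ a j)) \<le> real (card (?W v))"
    if v: "v \<in> prefix_families X a S" for v
  proof -
    have "card (?B v) \<le> (\<Sum>j\<in>S. card {w \<in> words X (a x). prefix (v j) w})"
      by (rule card_UN_le) fact
    also have "\<dots> = (\<Sum>j\<in>S. card X ^ (a x - a j))"
      using v assms by (intro sum.cong card_words_with_prefix) (auto simp: prefix_families_def PiE_iff)
    finally have "real (card (?B v)) \<le> (\<Sum>j\<in>S. ?n ^ (a x - a j))"
      by (metis (mono_tags, lifting) of_nat_le_iff of_nat_power of_nat_sum sum.cong)
    also have "\<dots> = (\<Sum>j\<in>S. ?n ^ a x / ?n ^ a j)"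
      using assms n by (intro sum.cong power_diff) auto
    finally have B: "real (card (?B v)) \<le> (\<Sum>j\<in>S. ?n ^ a x / ?n ^ a j)" .
    have "card (words X (a x)) \<le> card (?W v) + card (?B v)"
      using diff_card_le_card_Diff[of "?B v" "words X (a x)"] finite_subset[OF _ finite_words[OF assms(1)], of "?B v" "a x"]
      by fastforce
    then have "real (card (words X (a x))) \<le> real (card (?W v)) + real (card (?B v))"
      by linarith
    then have "?n ^ a x \<le> real (card (?W v)) + real (card (?B v))"
      using assms(1) by (simp add: card_words)
    then show ?thesis
      using B by (simp add: right_diff_distrib sum_distrib_left)
  qed
  have fin: "finite (prefix_families X a S)" using assms by (simp add: finite_prefix_families)
  have "real (card (prefix_families X a S)) * (?n ^ a x * (1 - (\<Sum>j\<in>S. 1 / ?n ^ a j)))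
      \<le> (\<Sum>v\<in>prefix_families X a S. real (card (?W v)))"
    using W by (intro sum_bounded_below) auto
  also have "\<dots> = real (card (Sigma (prefix_families X a S) ?W))"
    using fin assms by (subst card_SigmaI) (auto simp: finite_words)
  also have "card (Sigma (prefix_families X a S) ?W) \<le> card (prefix_families X a (insert x S))"
  proof (rule card_inj_on_le[where f = "\<lambda>(v, w). v(x := w)"])
    show "inj_on (\<lambda>(v, w). v(x := w)) (Sigma (prefix_families X a S) ?W)"
    proof (rule inj_onI, clarify)
      fix v w v' w'
      assume v: "v \<in> prefix_families X a S" "v' \<in> prefix_families X a S"
        and eq: "v(x := w) = v'(x := w')"
      \<comment> \<open>Both are \<open>undefined\<close> at \<open>x\<close>, which lies outside
        \<open>S\<close>, so the update at \<open>x\<close> loses no information.\<close>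
      have "v x = v' x"
        using v assms(4) by (auto simp: prefix_families_def PiE_iff extensional_def)
      then have "v = v'" using eq by (metis fun_upd_idem_iff fun_upd_upd)
      then show "v = v' \<and> w = w'" using fun_cong[OF eq, of x] by simp
    qed
    show "(\<lambda>(v, w). v(x := w)) ` Sigma (prefix_families X a S) ?W \<subseteq> prefix_families X a (insert x S)"
      using assms(4,5) by (auto intro!: prefix_families_insert)
  qed (use assms in \<open>simp add: finite_prefix_families\<close>)
  finally show ?thesis by (simp add: mult.assoc)
qed

text \<open>Iterating the previous estimate gives a product of Kraft defects of subfamilies, each at
  least \<open>varsigma n m\<close> by monotonicity. The first word is unrestricted, which saves one
  power.\<close>

lemma card_prefix_families_ge:
  fixes a :: "'i \<Rightarrow> nat"
  assumes X: "finite X" "card X = n" and n: "n \<ge> 2"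
    and "finite I" "card I \<le> m" "(\<Sum>i\<in>I. 1 / real n ^ a i) \<le> 1"
  shows "real n ^ (\<Sum>i\<in>I. a i) * varsigma n m ^ (card I - 1) \<le> real (card (prefix_families X a I))"
  using assms(4-6)
proof (induction I rule: finite_ranking_induct[where f = a])
  case empty
  have "prefix_families X a {} = {\<lambda>_. undefined}" by (simp add: prefix_families_def)
  then show ?case by simp
next
  case (insert x S)
  show ?case
  proof (cases "x \<in> S")
    case True
    then show ?thesis using insert by (simp add: insert_absorb)
  next
    case False
    let ?s = "\<Sum>i\<in>S. 1 / real n ^ a i"
    \<comment> \<open>The positive weight of \<open>x\<close> makes the Kraft sum over
      \<open>S\<close> strictly less than 1, as the defect bound requires.\<close>
    have "1 / real n ^ a x > 0" using n by simp
    moreover have "1 / real n ^ a x + ?s \<le> 1" using insert.prems insert.hyps False by simp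
    ultimately have s: "?s < 1" by linarith
    have "X \<noteq> {}" using X n by auto
    have card: "card S \<le> m" using insert False by simp
    have "varsigma n m ^ card S \<le> varsigma n m ^ (card S - 1) * (1 - ?s)"
    \<comment> \<open>For empty \<open>S\<close> the truncated exponent \<open>card S - 1\<close> is
      0 and the defect is 1, so both sides equal 1.\<close>
    proof (cases "S = {}")
      case True
      then show ?thesis by simp
    next
      case False
      then have "card S > 0" using insert by (simp add: card_gt_0_iff)
      then have "varsigma n m ^ card S = varsigma n m ^ (card S - 1) * varsigma n m"
        by (metis power_minus_mult)
      moreover have "varsigma n m \<le> 1 - ?s"
        using varsigma_antimono[OF n card] kraft_defect_ge_varsigma[OF n insert.hyps(1) s] by linarith
      ultimately show ?thesis
        using varsigma_pos[OF n, of m] by (simp add: mult_left_mono)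
    qed
    then have "real n ^ (\<Sum>i\<in>insert x S. a i) * varsigma n m ^ (card (insert x S) - 1)
        \<le> real n ^ (\<Sum>i\<in>insert x S. a i) * (varsigma n m ^ (card S - 1) * (1 - ?s))"
      using insert.hyps False by (intro mult_left_mono) auto
    also have "\<dots> = (real n ^ (\<Sum>i\<in>S. a i) * varsigma n m ^ (card S - 1)) * (real n ^ a x * (1 - ?s))"
      using insert.hyps False by (simp add: power_add)
    also have "\<dots> \<le> real (card (prefix_families X a S)) * (real n ^ a x * (1 - ?s))"
      using s card insert.IH by (intro mult_right_mono) auto
    also have "\<dots> \<le> real (card (prefix_families X a (insert x S)))"
      using card_prefix_families_insert[of X S x a] X \<open>X \<noteq> {}\<close> insert.hyps False
      by (simp add: mult.assoc)
    finally show ?thesis .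
  qed
qed

lemma card_prefix_families_le_card_PR:
  assumes "\<forall>a\<in>set L. 0 < a"
  shows "card (prefix_families {..<n} ((!) L) {..<length L}) \<le> card (PR n L)"
proof (rule card_inj_on_le[where f = "\<lambda>v. map v [0..<length L]"])
  let ?F = "prefix_families {..<n} ((!) L) {..<length L}"
  show "inj_on (\<lambda>v. map v [0..<length L]) ?F"
    by (rule inj_onI, rule PiE_ext) (auto simp: prefix_families_def)
  show "(\<lambda>v. map v [0..<length L]) ` ?F \<subseteq> PR n L"
  proof clarify
    fix v assume "v \<in> ?F"
    then have w: "\<And>i. i < length L \<Longrightarrow> v i \<in> words {..<n} (L ! i)"
      and pf: "\<And>i j. i < length L \<Longrightarrow> j < length L \<Longrightarrow> i \<noteq> j \<Longrightarrow> \<not> prefix (v i) (v j)"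
      by (auto simp: prefix_families_def)
    \<comment> \<open>Equal words would be prefixes of each other.\<close>
    have "distinct (map v [0..<length L])"
      using pf by (force simp: distinct_conv_nth)
    moreover have "[] \<notin> set (map v [0..<length L])"
    proof
      assume "[] \<in> set (map v [0..<length L])"
      then obtain i where "i < length L" "v i = []" by auto
      then show False using w[of i] assms nth_mem[of i L] by (auto simp: words_def)
    qed
    ultimately have "prefix_code (map v [0..<length L])"
      using pf by (simp add: prefix_code_def)
    then show "map v [0..<length L] \<in> PR n L"
      using w by (auto simp: PR_def codes_def words_def)
  qed
  show "finite (PR n L)" using PR_subset_UD finite_UD by (rule finite_subset)
qed

section \<open>The bounds\<close>

text \<open>The words 1, 01, 001, ... form a prefix code over two letters. Nonemptiness makes the
  infimum in \<open>xi\<close> meaningful.\<close>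

lemma length_dists_nonempty:
  assumes "n \<ge> 2"
  shows "length_dists n m \<noteq> {}"
proof -
  define w :: "nat \<Rightarrow> nat list" where "w = (\<lambda>i. replicate i 0 @ [1])"
  have w_prefix: "i = j" if "prefix (w i) (w j)" for i j
  proof -
    \<comment> \<open>The number of leading zeros recovers the index from any extension of the
      word.\<close>
    have zeros: "length (takeWhile (\<lambda>x. x = 0) (w k @ zs)) = k" for k zs
      by (induction k) (auto simp: w_def)
    obtain zs where "w j = w i @ zs"
      using \<open>prefix (w i) (w j)\<close> unfolding prefix_def by blast
    then show ?thesis
      using zeros[of i zs] zeros[of j "[]"] by simp
  qed
  then have "inj w" by (metis injI prefix_order.refl)
  have "prefix_code (map w [0..<m])"
    unfolding prefix_code_def
  proof (intro conjI allI impI)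
    show "distinct (map w [0..<m])"
      using \<open>inj w\<close> by (auto simp: distinct_map intro: inj_on_subset)
    show "[] \<notin> set (map w [0..<m])"
      by (auto simp: w_def)
  qed (use w_prefix in auto)
  moreover have "map w [0..<m] \<in> codes {..<n} (map Suc [0..<m])"
    using assms by (auto simp: codes_def w_def)
  ultimately have "UD n (map Suc [0..<m]) \<noteq> {}"
    by (auto simp: UD_def prefix_code_imp_uniquely_decodable)
  then have "map Suc [0..<m] \<in> length_dists n m"
    by (auto simp: length_dists_def)
  then show ?thesis by blast
qed

lemma ratio_ge_varsigma_power:
  assumes n: "n \<ge> 2" and L: "L \<in> length_dists n m"
  shows "varsigma n m ^ (m - 1) \<le> real (card (PR n L)) / real (card (UD n L))"
proof -
  have len: "length L = m" and pos: "\<forall>a\<in>set L. 0 < a" and ne: "UD n L \<noteq> {}"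
    using L by (auto simp: length_dists_def)
  obtain vs where "vs \<in> codes {..<n} L" "uniquely_decodable vs"
    using ne by (auto simp: UD_def)
  then have "(\<Sum>i<length L. 1 / real n ^ (L ! i)) \<le> 1"
    using mcmillan_inequality[of "{..<n}" vs L] n by (auto simp: lessThan_empty_iff)
  then have "real n ^ (\<Sum>i<m. L ! i) * varsigma n m ^ (m - 1)
      \<le> real (card (prefix_families {..<n} ((!) L) {..<m}))"
    using card_prefix_families_ge[of "{..<n}" n "{..<m}" m "(!) L"] n len by auto
  also have "\<dots> \<le> real (card (PR n L))"
    using card_prefix_families_le_card_PR[OF pos, of n] len by simp
  finally have PR: "real n ^ (\<Sum>i<m. L ! i) * varsigma n m ^ (m - 1) \<le> real (card (PR n L))" .
  have "card (UD n L) \<le> card (codes {..<n} L)"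
    by (rule card_mono) (auto simp: UD_def finite_codes)
  also have "\<dots> \<le> n ^ (\<Sum>i<m. L ! i)"
    using card_codes_le[of "{..<n}" L] len by simp
  finally have "real (card (UD n L)) \<le> real n ^ (\<Sum>i<m. L ! i)"
    by (metis of_nat_le_iff of_nat_power)
  then have "varsigma n m ^ (m - 1) * real (card (UD n L))
      \<le> varsigma n m ^ (m - 1) * real n ^ (\<Sum>i<m. L ! i)"
    using varsigma_pos[OF n, of m] by (intro mult_left_mono) auto
  moreover have "card (UD n L) > 0"
    using ne finite_UD by (simp add: card_gt_0_iff)
  ultimately show ?thesis
    using PR by (simp add: le_divide_eq mult.commute)
qed

lemma xi_ge_varsigma_power: "n \<ge> 2 \<Longrightarrow> varsigma n m ^ (m - 1) \<le> xi n m"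
  unfolding xi_def by (intro cINF_greatest length_dists_nonempty ratio_ge_varsigma_power)

lemma xi_le_1:
  assumes "n \<ge> 2"
  shows "xi n m \<le> 1"
proof -
  obtain L where L: "L \<in> length_dists n m" using length_dists_nonempty[OF assms] by blast
  have "xi n m \<le> real (card (PR n L)) / real (card (UD n L))"
    unfolding xi_def by (rule cINF_lower[OF _ L]) (auto intro!: bdd_belowI[where m = 0])
  also have "\<dots> \<le> 1"
    using card_mono[OF finite_UD PR_subset_UD, of n L] by (auto simp: divide_le_eq_1)
  finally show ?thesis .
qed

text \<open>Since \<open>k! \<le> k ^ k\<close>, multiplying a nonnegative lower bound by
  \<open>q_coeff n m\<close> can only weaken it.\<close>

lemma q_coeff_le_1: "q_coeff n m \<le> 1"
proof -
  have "fact k / real k ^ k \<le> 1" for k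
    using fact_le_power[of k, where 'a = real] by (auto simp: divide_le_eq_1)
  then show ?thesis unfolding q_coeff_def by (metis order_refl)
qed

lemma varsigma_tendsto_1: "(\<lambda>n. varsigma n m) \<longlonglongrightarrow> 1"
proof -
  have "(\<lambda>n. 1 - real m / real n) \<longlonglongrightarrow> 1 - 0"
    by (intro tendsto_intros lim_const_over_n)
  moreover have "eventually (\<lambda>n. 1 - real m / real n = varsigma n m) sequentially"
    \<comment> \<open>From here on \<open>m < n - 1\<close>, so the quotient in
      \<open>varsigma\<close> is 0 and the remainder is \<open>m\<close>.\<close>
    using eventually_ge_at_top[of "m + 2"]
    by eventually_elim (auto simp: varsigma_def field_simps)
  ultimately show ?thesis
    by (simp add: tendsto_cong)
qed

theorem corollary1:
  shows "(\<forall>n m :: nat. n \<ge> 2 \<and> m \<ge> 1 \<longrightarrow> xi n m \<ge> q_coeff n m * varsigma n m ^ (m - 1))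
    \<and> (\<forall>m :: nat. m \<ge> 1 \<longrightarrow> (\<lambda>n. xi n m) \<longlonglongrightarrow> 1)"
proof (intro conjI allI impI)
  fix n m :: nat assume "n \<ge> 2 \<and> m \<ge> 1"
  then have n: "n \<ge> 2" by simp
  have "q_coeff n m * varsigma n m ^ (m - 1) \<le> 1 * varsigma n m ^ (m - 1)"
    using q_coeff_le_1 varsigma_pos[OF n, of m] by (intro mult_right_mono) auto
  then show "xi n m \<ge> q_coeff n m * varsigma n m ^ (m - 1)"
    using xi_ge_varsigma_power[OF n, of m] by simp
next
  fix m :: nat
  have "(\<lambda>n. varsigma n m ^ (m - 1)) \<longlonglongrightarrow> 1 ^ (m - 1)"
    by (intro tendsto_power varsigma_tendsto_1)
  then have lower: "(\<lambda>n. varsigma n m ^ (m - 1)) \<longlonglongrightarrow> 1" by simp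
  show "(\<lambda>n. xi n m) \<longlonglongrightarrow> 1"
  proof (rule tendsto_sandwich[OF _ _ lower tendsto_const])
    show "eventually (\<lambda>n. varsigma n m ^ (m - 1) \<le> xi n m) sequentially"
      using eventually_ge_at_top[of 2] by eventually_elim (rule xi_ge_varsigma_power)
    show "eventually (\<lambda>n. xi n m \<le> 1) sequentially"
      using eventually_ge_at_top[of 2] by eventually_elim (rule xi_le_1)
  qed
qed

end
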